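(* Let $A,B\in\widehat{\mathbb{F}_q^{*}}$ with $A\neq\varepsilon$. Then $$ {}_{2}F_1\!\left(\begin{array}{cc} A, & B\\ & A\bar{B}\end{array}\Big|\;-1\right)_q^{\star}=\begin{cases}0 & \text{if } A \text{ is not a square},\\[4pt] \displaystyle\sum_{R^2=A}\frac{g(\bar{A})\,g(\bar{R}B)}{g(\bar{R})\,g(\bar{A}B)} & \text{otherwise.}\end{cases} $$
   Context: Let $q$ be a prime power and $\mathbb{F}_q$ the finite field with $q$ elements. $\widehat{\mathbb{F}_q^{*}}$ denotes the group of multiplicative characters of $\mathbb{F}_q^{*}$; every character $\chi$ (including the trivial character $\varepsilon$) is extended to $\mathbb{F}_q$ by $\chi(0):=0$. $\bar{\chi}$ denotes the inverse character, and juxtaposition denotes pointwise product of characters. Fix a non-trivial additive character $\theta$ of $\mathbb{F}_q$ and define the Gauss sum $g(\chi):=\sum_{x\in\mathbb{F}_q}\chi(x)\theta(x)$. For $A_0,A_1,B_1\in\widehat{\mathbb{F}_q^{*}}$ and $x\in\mathbb{F}_q$ define $$ {}_{2}F_1\!\left(\begin{array}{cc} A_0, & A_1\\ & B_1\end{array}\Big|\;x\right)_q^{\star}:=\frac{1}{q-1}\sum_{\chi\in\widehat{\mathbb{F}_q^{*}}}\frac{g(A_0\chi)}{g(A_0)}\frac{g(A_1\chi)}{g(A_1)}\frac{g(\overline{B_1\chi})}{g(\overline{B_1})}\,g(\bar{\chi})\,\chi(x). $$ "$A$ is a square" means $A=S^2$ for some character $S$; $\sum_{R^2=A}$ denotes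 the sum over all characters $R$ with $R^2=A$.
   Formalization: The formal theorem adds the hypothesis that q is odd or B ≠ ε: for q even (q ≥ 4), B = ε and A ≠ ε the left side equals 2 − q while the right side equals 1, so the claim as stated fails in exactly these cases. *)

theory Defs
  imports Complex_Main "HOL-Library.Cardinality"
begin

text \<open>
  The finite field with \<open>q\<close> elements is a type \<open>'a :: {field, finite}\<close>, with \<open>q = CARD('a)\<close>.
  A multiplicative character is represented by its extension to the whole field by \<open>\<chi> 0 = 0\<close>
  (also for the trivial character), so that distinct characters are distinct functions. Nonzero
  elements have nonzero values because \<open>\<chi> x * \<chi> (inverse x) = \<chi> 1 = 1\<close>.
\<close>

definition mult_chars :: "('a::field \<Rightarrow> complex) set" where
  "mult_chars = {\<chi>. \<chi> 0 = 0 \<and> \<chi> 1 = 1 \<and> (\<forall>x y. \<chi> (x * y) = \<chi> x * \<chi> y)}"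

definition triv_char :: "'a::field \<Rightarrow> complex" where
  "triv_char = (\<lambda>x. if x = 0 then 0 else 1)"

definition char_mult :: "('a::field \<Rightarrow> complex) \<Rightarrow> ('a \<Rightarrow> complex) \<Rightarrow> 'a \<Rightarrow> complex"
    (infixl "\<odot>" 70) where
  "\<chi> \<odot> \<psi> = (\<lambda>x. \<chi> x * \<psi> x)"

text \<open>Since \<open>inverse 0 = 0\<close>, the value at \<open>0\<close> is again \<open>0\<close>.\<close>

definition char_inv :: "('a::field \<Rightarrow> complex) \<Rightarrow> 'a \<Rightarrow> complex" where
  "char_inv \<chi> = (\<lambda>x. inverse (\<chi> x))"

definition nontrivial_add_char :: "('a::field \<Rightarrow> complex) \<Rightarrow> bool" where
  "nontrivial_add_char \<theta> \<longleftrightarrow>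
     \<theta> 0 = 1 \<and> (\<forall>x y. \<theta> (x + y) = \<theta> x * \<theta> y) \<and> (\<exists>x. \<theta> x \<noteq> 1)"

definition gauss_sum :: "('a::{field,finite} \<Rightarrow> complex) \<Rightarrow> ('a \<Rightarrow> complex) \<Rightarrow> complex" where
  "gauss_sum \<theta> \<chi> = (\<Sum>x\<in>UNIV. \<chi> x * \<theta> x)"

definition hyp2F1_star ::
  "('a::{field,finite} \<Rightarrow> complex) \<Rightarrow> ('a \<Rightarrow> complex) \<Rightarrow> ('a \<Rightarrow> complex) \<Rightarrow> ('a \<Rightarrow> complex) \<Rightarrow> 'a \<Rightarrow> complex"
where
  "hyp2F1_star \<theta> A\<^sub>0 A\<^sub>1 B\<^sub>1 x =
     1 / (of_nat CARD('a) - 1) *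
     (\<Sum>\<chi>\<in>mult_chars.
        gauss_sum \<theta> (A\<^sub>0 \<odot> \<chi>) / gauss_sum \<theta> A\<^sub>0 *
        (gauss_sum \<theta> (A\<^sub>1 \<odot> \<chi>) / gauss_sum \<theta> A\<^sub>1) *
        (gauss_sum \<theta> (char_inv (B\<^sub>1 \<odot> \<chi>)) / gauss_sum \<theta> (char_inv B\<^sub>1)) *
        gauss_sum \<theta> (char_inv \<chi>) * \<chi> x)"

definition is_square_char :: "('a::field \<Rightarrow> complex) \<Rightarrow> bool" where
  "is_square_char A \<longleftrightarrow> (\<exists>S\<in>mult_chars. A = S \<odot> S)"

text \<open>
  \<open>mult_chars\<close> is finite over a finite field, so the sums over it (which would be \<open>0\<close> by
  convention over an infinite index set) are genuine.
\<close>

lemma finite_mult_chars: "finite (mult_chars :: ('a::{field,finite} \<Rightarrow> complex) set)"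
proof -
  define n where "n = (\<Prod>k\<in>{1..CARD('a)}. k)"
  have npos: "n > 0" by (simp add: n_def prod_pos)
  have root: "\<chi> x \<in> insert 0 {z. z ^ n = 1}"
    if \<chi>: "\<chi> \<in> mult_chars" for \<chi> :: "'a \<Rightarrow> complex" and x
  proof (cases "x = 0")
    case True
    then show ?thesis using \<chi> by (simp add: mult_chars_def)
  next
    case False
    have "\<not> inj_on (\<lambda>k. x ^ k) {0..CARD('a)}"
    proof
      assume "inj_on (\<lambda>k. x ^ k) {0..CARD('a)}"
      then have "card {0..CARD('a)} \<le> card (UNIV :: 'a set)"
        by (rule card_inj_on_le) auto
      then show False by simp
    qed
    then obtain i j where ij: "i < j" "j \<le> CARD('a)" "x ^ i = x ^ j"
      unfolding inj_on_def by (metis atLeastAtMost_iff linorder_neqE_nat)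
    have "x ^ j = x ^ i * x ^ (j - i)"
      using ij(1) by (simp flip: power_add)
    with ij(3) False have xk: "x ^ (j - i) = 1" by simp
    have "j - i dvd n"
      unfolding n_def using ij by (intro dvd_prodI) auto
    then obtain m where "n = (j - i) * m" by (elim dvdE)
    with xk have "x ^ n = 1" by (simp add: power_mult)
    moreover have "\<chi> (x ^ k) = \<chi> x ^ k" for k
      using \<chi> by (induction k) (auto simp: mult_chars_def)
    ultimately show ?thesis using \<chi> by (metis (mono_tags, lifting) insertCI mem_Collect_eq mult_chars_def)
  qed
  have fin: "finite (insert 0 {z::complex. z ^ n = 1})"
    using npos by (simp add: finite_roots_unity Suc_leI)
  have "mult_chars \<subseteq> {\<chi> :: 'a \<Rightarrow> complex. \<forall>x. (x \<in> UNIV \<longrightarrow> \<chi> x \<in> insert 0 {z. z ^ n = 1})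
      \<and> (x \<notin> UNIV \<longrightarrow> \<chi> x = 0)}"
    using root by blast
  then show ?thesis
    by (rule finite_subset) (rule finite_set_of_finite_funs[OF finite fin])
qed

end

theory Submission
  imports Defs "HOL-Algebra.Algebraic_Closure_Type"
begin

text \<open>
  Expanding the four Gauss sums and summing over \<open>\<chi>\<close> by orthogonality reduces the hypergeometric
  sum to \<open>\<Sum>\<^sub>t A(t) K(1 + t) K(1 - t)\<close> with \<open>K(c) = \<Sum>\<^sub>z B(z) \<theta>(c z)\<close>, up to the Gauss sums in
  the denominator. For nontrivial \<open>B\<close> one has \<open>K(c) = B(c)\<^sup>-\<^sup>1 g(B)\<close>, so what remains is
  \<open>\<Sum>\<^sub>t A(t) B(1 - t\<^sup>2)\<^sup>-\<^sup>1\<close>. Since \<open>\<Sum>\<^sub>t A(t)\<close> over \<open>t\<^sup>2 = u\<close> equals \<open>\<Sum>\<^sub>R R(u)\<close> over \<open>R\<^sup>2 = A\<close>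
  (orthogonality once more), this is a sum of Jacobi sums, one for each square root \<open>R\<close> of \<open>A\<close>; there
  are none if \<open>A\<close> is not a square. For trivial \<open>B\<close> and odd \<open>q\<close> both sides equal \<open>1 + A(-1)\<close>.
\<close>

no_notation module.smult (infixl "\<odot>\<index>" 70)

subsection \<open>Multiplicative characters\<close>

lemma mult_charsD:
  assumes "\<chi> \<in> mult_chars"
  shows mult_chars_0: "\<chi> 0 = 0"
    and mult_chars_1: "\<chi> 1 = 1"
    and mult_chars_mult: "\<chi> (x * y) = \<chi> x * \<chi> y"
  using assms by (auto simp: mult_chars_def)

lemma mult_chars_inverse:
  assumes "\<chi> \<in> mult_chars"
  shows "\<chi> (inverse x) = inverse (\<chi> x)"
proof (cases "x = 0")
  case False
  then have "\<chi> x * \<chi> (inverse x) = 1"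
    using mult_charsD[OF assms] by (metis right_inverse)
  then show ?thesis by (metis inverse_unique)
qed (simp add: mult_chars_0[OF assms])

lemma mult_chars_eq_0_iff:
  assumes "\<chi> \<in> mult_chars"
  shows "\<chi> x = 0 \<longleftrightarrow> x = 0"
  using mult_charsD[OF assms] by (metis mult_zero_left right_inverse zero_neq_one)

lemma mult_chars_minus_1_square:
  assumes "\<chi> \<in> mult_chars"
  shows "\<chi> (-1) * \<chi> (-1) = 1"
  using mult_charsD[OF assms] by (metis minus_mult_minus mult_1)

lemma triv_char_in_mult_chars: "triv_char \<in> mult_chars"
  by (auto simp: mult_chars_def triv_char_def)

lemma char_mult_in_mult_chars:
  "\<chi> \<in> mult_chars \<Longrightarrow> \<psi> \<in> mult_chars \<Longrightarrow> \<chi> \<odot> \<psi> \<in> mult_chars"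
  by (auto simp: mult_chars_def char_mult_def)

lemma char_inv_in_mult_chars: "\<chi> \<in> mult_chars \<Longrightarrow> char_inv \<chi> \<in> mult_chars"
  by (auto simp: mult_chars_def char_inv_def)

lemma char_mult_char_inv_eq_triv_char_iff:
  assumes "\<chi> \<in> mult_chars" "\<psi> \<in> mult_chars"
  shows "\<chi> \<odot> char_inv \<psi> = triv_char \<longleftrightarrow> \<chi> = \<psi>"
proof -
  have "\<chi> x * inverse (\<psi> x) = triv_char x \<longleftrightarrow> \<chi> x = \<psi> x" for x
    using assms by (cases "x = 0") (auto simp: mult_chars_0 mult_chars_eq_0_iff triv_char_def field_simps)
  then show ?thesis by (simp add: fun_eq_iff char_mult_def char_inv_def)
qed

section \<open>Orthogonality: sums of one character over the field\<close>

lemma sum_UNIV_mult_right: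
  fixes f :: "'a::{field,finite} \<Rightarrow> 'b::comm_monoid_add"
  assumes "c \<noteq> 0"
  shows "(\<Sum>x\<in>UNIV. f (x * c)) = (\<Sum>x\<in>UNIV. f x)"
  by (rule sum.reindex_bij_witness[of _ "\<lambda>x. x / c" "\<lambda>x. x * c"]) (use assms in auto)

lemma of_nat_CARD_minus_1_neq_0: "of_nat CARD('a::{field,finite}) - (1::complex) \<noteq> 0"
proof -
  have "card {0, 1 :: 'a} \<le> CARD('a)" by (rule card_mono) auto
  then have "CARD('a) \<noteq> 1" by simp
  then show ?thesis by (metis eq_iff_diff_eq_0 of_nat_1 of_nat_eq_iff)
qed

lemma sum_mult_char:
  fixes \<chi> :: "'a::{field,finite} \<Rightarrow> complex"
  assumes "\<chi> \<in> mult_chars"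
  shows "(\<Sum>x\<in>UNIV. \<chi> x) = (if \<chi> = triv_char then of_nat CARD('a) - 1 else 0)"
proof (cases "\<chi> = triv_char")
  case True
  have "(\<Sum>x\<in>UNIV. triv_char (x::'a)) = (\<Sum>x\<in>UNIV - {0::'a}. 1)"
    by (rule sum.mono_neutral_cong_right) (auto simp: triv_char_def)
  also have "\<dots> = of_nat CARD('a) - 1"
    by (simp add: card_Diff_singleton of_nat_diff Suc_le_eq)
  finally show ?thesis using True by simp
next
  case False
  then obtain a where a: "\<chi> a \<noteq> triv_char a" by auto
  then have a0: "a \<noteq> 0" using assms by (auto simp: mult_chars_0 triv_char_def)
  \<comment> \<open>Scaling the variable by \<open>a\<close> multiplies the sum by
    \<open>\<chi> a\<close>, which differs from 1, so the sum must vanish.\<close>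
  have "(\<Sum>x\<in>UNIV. \<chi> x) = (\<Sum>x\<in>UNIV. \<chi> (x * a))"
    using sum_UNIV_mult_right[OF a0] by metis
  also have "\<dots> = (\<Sum>x\<in>UNIV. \<chi> x) * \<chi> a"
    by (simp add: mult_chars_mult[OF assms] sum_distrib_right)
  finally show ?thesis using a a0 False by (auto simp: triv_char_def)
qed

lemma sum_mult_char_divide:
  fixes \<chi> \<psi> :: "'a::{field,finite} \<Rightarrow> complex"
  assumes "\<chi> \<in> mult_chars" "\<psi> \<in> mult_chars"
  shows "(\<Sum>x\<in>UNIV. \<chi> x * inverse (\<psi> x)) = (if \<chi> = \<psi> then of_nat CARD('a) - 1 else 0)"
proof -
  have "\<chi> \<odot> char_inv \<psi> \<in> mult_chars"
    using assms by (intro char_mult_in_mult_chars char_inv_in_mult_chars)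
  from sum_mult_char[OF this] show ?thesis
    unfolding char_mult_char_inv_eq_triv_char_iff[OF assms] by (simp add: char_mult_def char_inv_def)
qed

section \<open>Dual orthogonality: sums over all characters at one point\<close>

lemma finite_field_generator:
  obtains g :: "'a::{field,finite}" where "g \<noteq> 0" "\<And>x. x \<noteq> 0 \<Longrightarrow> \<exists>i::nat. x = g ^ i"
proof -
  define K where "K = (ring_of_type_algebra :: 'a ring)"
  interpret K: field K unfolding K_def by rule
  have carr: "carrier (mult_of K) = UNIV - {0}"
    by (auto simp: K_def ring_of_type_algebra_def carrier_mult_of)
  have pow: "x [^]\<^bsub>K\<^esub> (i::nat) = x ^ i" for x i
    by (induction i) (auto simp: K_def ring_of_type_algebra_def mult.commute)
  have "finite (carrier K)" by (rule finite_subset[of _ UNIV]) auto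
  from K.finite_field_mult_group_has_gen[OF this] obtain g where
    g: "g \<in> carrier (mult_of K)" "carrier (mult_of K) = {g [^]\<^bsub>K\<^esub> i | i::nat. i \<in> UNIV}"
    by (auto simp: nat_pow_mult_of)
  show thesis
  proof
    show "g \<noteq> 0" using g(1) unfolding carr by simp
    show "\<exists>i::nat. x = g ^ i" if "x \<noteq> 0" for x
      using g(2) that unfolding carr pow by blast
  qed
qed

text \<open>The multiplicative group is cyclic. Sending a generator \<open>g\<close> of order
  \<open>n\<close> to a primitive \<open>n\<close>-th root of unity gives an injective character,
  and this single character separates every \<open>a\<close> from 1.\<close>

lemma mult_chars_separate:
  fixes a :: "'a::{field,finite}"
  assumes "a \<noteq> 0" "a \<noteq> 1"
  obtains \<chi> where "\<chi> \<in> mult_chars" "\<chi> a \<noteq> 1"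
proof -
  obtain g :: 'a where g: "g \<noteq> 0" "\<And>x. x \<noteq> 0 \<Longrightarrow> \<exists>i::nat. x = g ^ i"
    by (rule finite_field_generator) blast
  obtain k where "inverse g = g ^ k" using g by (metis nonzero_imp_inverse_nonzero)
  then have "g ^ Suc k = 1" using g(1) by (metis power_Suc right_inverse)
  then have ex: "\<exists>n>0. g ^ n = 1" by blast
  define n where "n = (LEAST n. n > 0 \<and> g ^ n = 1)"
  have n: "n > 0" "g ^ n = 1" using LeastI_ex[OF ex] by (auto simp: n_def)
  have n_min: "g ^ m \<noteq> 1" if "m > 0" "m < n" for m
    using not_less_Least[of m "\<lambda>n. n > 0 \<and> g ^ n = 1"] that by (auto simp: n_def)
  \<comment> \<open>Stated for any monoid because it serves both the field element \<open>g\<close>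
    and the complex number \<open>\<zeta>\<close>.\<close>
  have red: "z ^ i = z ^ (i mod n)" if "z ^ n = 1" for z :: "'b::monoid_mult" and i
  proof -
    have "z ^ i = z ^ (n * (i div n) + i mod n)" by simp
    then show ?thesis by (simp only: power_add power_mult that power_one mult_1_left)
  qed
  have inj: "i = j" if "i \<le> j" "j < n" "g ^ i = g ^ j" for i j
  proof (rule ccontr)
    assume "i \<noteq> j"
    have "g ^ j = g ^ i * g ^ (j - i)" using that(1) by (simp flip: power_add)
    then have "g ^ (j - i) = 1" using that g(1) by simp
    then show False using n_min[of "j - i"] that \<open>i \<noteq> j\<close> by simp
  qed
  have exp_mod: "i mod n = j mod n" if "g ^ i = g ^ j" for i j
  proof -
    have "g ^ (i mod n) = g ^ (j mod n)" using that red[of g] n(2) by metis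
    then show ?thesis using inj n(1) by (metis mod_less_divisor nle_le)
  qed
  define \<zeta> where "\<zeta> = cis (2 * pi / n)"
  have \<zeta>_pow: "\<zeta> ^ i = cis (2 * pi * real i / real n)" for i
    by (simp add: \<zeta>_def DeMoivre mult_ac)
  have \<zeta>n: "\<zeta> ^ n = 1" using n(1) by (simp add: \<zeta>_pow)
  have \<zeta>_eq: "\<zeta> ^ i = \<zeta> ^ j" if "g ^ i = g ^ j" for i j
    using exp_mod[OF that] red[of \<zeta>, OF \<zeta>n] by metis
  \<comment> \<open>A discrete logarithm to base \<open>g\<close>. It is determined only modulo
    \<open>n\<close>, and by \<open>\<zeta>_eq\<close> the powers of \<open>\<zeta>\<close> do not
    see the choice.\<close>
  define e where "e x = (SOME i::nat. x = g ^ i)" for x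
  have e: "g ^ e x = x" if "x \<noteq> 0" for x
    using someI_ex[OF g(2)[OF that]] by (simp add: e_def)
  define \<chi> where "\<chi> x = (if x = 0 then 0 else \<zeta> ^ e x)" for x
  have "\<chi> \<in> mult_chars"
  proof -
    have "\<zeta> ^ e (x * y) = \<zeta> ^ e x * \<zeta> ^ e y" if "x \<noteq> 0" "y \<noteq> 0" for x y
      using \<zeta>_eq[of "e (x * y)" "e x + e y"] that e by (simp add: power_add)
    moreover have "\<zeta> ^ e 1 = 1" using \<zeta>_eq[of "e 1" 0] e by simp
    ultimately show ?thesis by (auto simp: mult_chars_def \<chi>_def)
  qed
  moreover have "\<chi> a \<noteq> 1"
  proof
    assume "\<chi> a = 1"
    then have "\<zeta> ^ (e a mod n) = \<zeta> ^ 0" using assms red[of \<zeta>, OF \<zeta>n] by (metis \<chi>_def power_0)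
    \<comment> \<open>Primitivity of \<open>\<zeta>\<close>: its powers with exponents below
      \<open>n\<close> are distinct, so \<open>\<chi> a = 1\<close> forces \<open>n\<close> to
      divide \<open>e a\<close>.\<close>
    moreover have "inj_on (\<lambda>k. cis (2 * pi * real k / real n)) {..<n}"
      using bij_betw_roots_unity[OF n(1)] by (simp add: bij_betw_def)
    ultimately have "e a mod n = 0"
      unfolding \<zeta>_pow using n(1) by (auto simp only: lessThan_iff mod_less_divisor dest!: inj_onD)
    then have "g ^ e a = 1" using red[of g "e a"] n(2) by simp
    then show False using e assms by simp
  qed
  ultimately show thesis by (rule that)
qed

text \<open>Multiplication by a character \<open>\<psi>\<close> with
  \<open>\<psi> a \<noteq> 1\<close> permutes all characters and scales the sum by
  \<open>\<psi> a\<close>.\<close>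

lemma sum_mult_chars_eq_0:
  fixes a :: "'a::{field,finite}"
  assumes "a \<noteq> 1"
  shows "(\<Sum>\<chi>\<in>mult_chars. \<chi> a) = 0"
proof (cases "a = 0")
  case False
  then obtain \<psi> :: "'a \<Rightarrow> complex" where \<psi>: "\<psi> \<in> mult_chars" "\<psi> a \<noteq> 1"
    using assms by (rule mult_chars_separate)
  \<comment> \<open>At 0 the factor \<open>\<psi>\<close> cannot be cancelled, but there
    \<open>\<chi>\<close> vanishes as well.\<close>
  have cancel: "\<chi> \<odot> char_inv \<psi> \<odot> \<psi> = \<chi>" "\<chi> \<odot> \<psi> \<odot> char_inv \<psi> = \<chi>"
    if "\<chi> \<in> mult_chars" for \<chi> :: "'a \<Rightarrow> complex"
  proof -
    have "\<chi> x * inverse (\<psi> x) * \<psi> x = \<chi> x" "\<chi> x * \<psi> x * inverse (\<psi> x) = \<chi> x" for x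
      using mult_chars_eq_0_iff[OF \<psi>(1)] mult_chars_0[OF that] by (cases "x = 0"; simp)+
    then show "\<chi> \<odot> char_inv \<psi> \<odot> \<psi> = \<chi>" "\<chi> \<odot> \<psi> \<odot> char_inv \<psi> = \<chi>"
      by (simp_all add: fun_eq_iff char_mult_def char_inv_def)
  qed
  have "(\<Sum>\<chi>\<in>mult_chars. \<chi> a) = (\<Sum>\<chi>\<in>mult_chars. (\<chi> \<odot> \<psi>) a)"
    by (rule sum.reindex_bij_witness[of _ "\<lambda>\<chi>. \<chi> \<odot> \<psi>" "\<lambda>\<chi>. \<chi> \<odot> char_inv \<psi>"])
       (auto simp: cancel char_mult_in_mult_chars char_inv_in_mult_chars \<psi>)
  also have "\<dots> = (\<Sum>\<chi>\<in>mult_chars. \<chi> a) * \<psi> a"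
    by (simp add: char_mult_def sum_distrib_right)
  finally show ?thesis using \<psi> by simp
qed (simp add: mult_chars_0)

text \<open>The case \<open>a = 1\<close>, that is, the number of characters, comes from evaluating
  \<open>\<Sum>\<^sub>\<chi> \<Sum>\<^sub>x \<chi> x\<close> in both orders.\<close>

lemma sum_mult_chars:
  fixes a :: "'a::{field,finite}"
  shows "(\<Sum>\<chi>\<in>mult_chars. \<chi> a) = (if a = 1 then of_nat CARD('a) - 1 else 0)"
proof (cases "a = 1")
  case True
  have "(\<Sum>\<chi>\<in>mult_chars. \<Sum>x\<in>UNIV. \<chi> (x::'a)) =
      (\<Sum>\<chi>\<in>mult_chars. if \<chi> = (triv_char :: 'a \<Rightarrow> complex) then of_nat CARD('a) - 1 else 0)"
    by (rule sum.cong) (auto simp: sum_mult_char)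
  also have "\<dots> = of_nat CARD('a) - 1"
    by (simp add: finite_mult_chars triv_char_in_mult_chars)
  finally have "of_nat CARD('a) - 1 = (\<Sum>x\<in>UNIV. \<Sum>\<chi>\<in>mult_chars. \<chi> (x::'a))"
    by (subst sum.swap) simp
  also have "\<dots> = (\<Sum>x\<in>{1}. \<Sum>\<chi>\<in>mult_chars. \<chi> (x::'a))"
    by (rule sum.mono_neutral_right) (auto simp: sum_mult_chars_eq_0)
  finally show ?thesis using True by simp
qed (simp add: sum_mult_chars_eq_0)

text \<open>Evaluate the double sum of A(t) R(u / t^2) over t and R in both orders. Summing over t
  first detects R^2 = A, summing over R first detects t^2 = u, each time with weight q - 1.\<close>

lemma sum_square_root_chars:
  fixes A :: "'a::{field,finite} \<Rightarrow> complex"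
  assumes A: "A \<in> mult_chars"
  shows "(\<Sum>R | R \<in> mult_chars \<and> R \<odot> R = A. R u) = (\<Sum>t | t * t = u. A t)"
proof (cases "u = 0")
  case True
  then show ?thesis by (simp add: mult_chars_0[OF A] mult_chars_0)
next
  case u: False
  let ?n = "of_nat CARD('a) - 1 :: complex"
  have "?n * (\<Sum>R | R \<in> mult_chars \<and> R \<odot> R = A. R u) =
      (\<Sum>R\<in>mult_chars. if R \<odot> R = A then ?n * R u else 0)"
    unfolding sum_distrib_left by (rule sum.inter_filter[OF finite_mult_chars])
  also have "\<dots> = (\<Sum>R\<in>mult_chars. \<Sum>t\<in>UNIV. A t * R (u * inverse (t * t)))"
  proof (rule sum.cong)
    fix R :: "'a \<Rightarrow> complex" assume R: "R \<in> mult_chars"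
    have "(\<Sum>t\<in>UNIV. A t * R (u * inverse (t * t))) =
        R u * (\<Sum>t\<in>UNIV. A t * inverse ((R \<odot> R) t))"
      by (simp add: sum_distrib_left mult_chars_mult[OF R] mult_chars_inverse[OF R] char_mult_def mult_ac)
    also have "\<dots> = (if R \<odot> R = A then ?n * R u else 0)"
      using sum_mult_char_divide[OF A char_mult_in_mult_chars[OF R R]] by auto
    finally show "(if R \<odot> R = A then ?n * R u else 0) = (\<Sum>t\<in>UNIV. A t * R (u * inverse (t * t)))"
      by simp
  qed simp
  also have "\<dots> = (\<Sum>t\<in>UNIV. A t * (\<Sum>R\<in>mult_chars. R (u * inverse (t * t))))"
    by (subst sum.swap) (simp add: sum_distrib_left)
  also have "\<dots> = (\<Sum>t\<in>UNIV. if t * t = u then ?n * A t else 0)"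
  proof (rule sum.cong)
    fix t :: 'a
    \<comment> \<open>At \<open>t = 0\<close> the left side is false because
      \<open>inverse 0 = 0\<close>, and the right side is false because \<open>u \<noteq> 0\<close>;
      hence the separate case \<open>u = 0\<close>.\<close>
    have "u * inverse (t * t) = 1 \<longleftrightarrow> t * t = u"
      using u by (cases "t = 0") (auto simp: field_simps)
    then show "A t * (\<Sum>R\<in>mult_chars. R (u * inverse (t * t))) = (if t * t = u then ?n * A t else 0)"
      by (simp add: sum_mult_chars)
  qed simp
  also have "\<dots> = ?n * (\<Sum>t | t * t = u. A t)"
    using sum.inter_filter[of UNIV "\<lambda>t. ?n * A t" "\<lambda>t. t * t = u"]
    by (simp add: sum_distrib_left)
  finally show ?thesis using of_nat_CARD_minus_1_neq_0[where 'a='a] by simp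
qed

subsection \<open>Gauss and Jacobi sums\<close>

lemma nontrivial_add_charD:
  assumes "nontrivial_add_char \<theta>"
  shows nontrivial_add_char_0: "\<theta> 0 = 1"
    and nontrivial_add_char_add: "\<theta> (x + y) = \<theta> x * \<theta> y"
  using assms by (auto simp: nontrivial_add_char_def)

lemma sum_nontrivial_add_char:
  fixes \<theta> :: "'a::{field,finite} \<Rightarrow> complex"
  assumes "nontrivial_add_char \<theta>"
  shows "(\<Sum>x\<in>UNIV. \<theta> x) = 0"
proof -
  obtain a where a: "\<theta> a \<noteq> 1" using assms by (auto simp: nontrivial_add_char_def)
  have "(\<Sum>x\<in>UNIV. \<theta> x) = (\<Sum>x\<in>UNIV. \<theta> (x + a))"
    by (rule sum.reindex_bij_witness[of _ "\<lambda>x. x + a" "\<lambda>x. x - a"]) auto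
  also have "\<dots> = (\<Sum>x\<in>UNIV. \<theta> x) * \<theta> a"
    by (simp add: nontrivial_add_char_add[OF assms] sum_distrib_right)
  finally show ?thesis using a by simp
qed

text \<open>The convention that the trivial character is 0 at 0 removes just the term
  \<open>\<theta> 0 = 1\<close> from a vanishing sum.\<close>

lemma gauss_sum_triv_char:
  assumes "nontrivial_add_char \<theta>"
  shows "gauss_sum \<theta> triv_char = -1"
proof -
  have "gauss_sum \<theta> triv_char = (\<Sum>x\<in>UNIV - {0}. \<theta> x)"
    unfolding gauss_sum_def by (rule sum.mono_neutral_cong_right) (auto simp: triv_char_def)
  then show ?thesis
    using sum_nontrivial_add_char[OF assms] nontrivial_add_char_0[OF assms]
    by (simp add: sum_diff1)
qed

lemma gauss_sum_twist:
  assumes "\<chi> \<in> mult_chars" "c \<noteq> 0"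
  shows "(\<Sum>x\<in>UNIV. \<chi> x * \<theta> (x * c)) = inverse (\<chi> c) * gauss_sum \<theta> \<chi>"
proof -
  have "gauss_sum \<theta> \<chi> = (\<Sum>x\<in>UNIV. \<chi> (x * c) * \<theta> (x * c))"
    unfolding gauss_sum_def by (rule sum_UNIV_mult_right[OF assms(2), symmetric])
  also have "\<dots> = \<chi> c * (\<Sum>x\<in>UNIV. \<chi> x * \<theta> (x * c))"
    by (simp add: mult_chars_mult[OF assms(1)] sum_distrib_left mult_ac)
  finally show ?thesis using mult_chars_eq_0_iff[OF assms(1)] assms(2) by simp
qed

section \<open>Jacobi sums and their relation to Gauss sums\<close>

definition jacobi_sum :: "('a::{field,finite} \<Rightarrow> complex) \<Rightarrow> ('a \<Rightarrow> complex) \<Rightarrow> complex" where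
  "jacobi_sum \<chi> \<psi> = (\<Sum>u\<in>UNIV. \<chi> u * \<psi> (1 - u))"

text \<open>Collect the pairs (x, y) by s = x + y. For s other than 0, scaling x by s splits off a
  Jacobi sum; s = 0 leaves the last term, which survives only if the product character is trivial.
  Keeping that term makes one identity serve both the Jacobi quotient formula and the product of g
  at a character and its inverse.\<close>

lemma gauss_sum_mult:
  fixes \<theta> \<chi> \<psi> :: "'a::{field,finite} \<Rightarrow> complex"
  assumes \<theta>: "nontrivial_add_char \<theta>" and \<chi>: "\<chi> \<in> mult_chars" and \<psi>: "\<psi> \<in> mult_chars"
  shows "gauss_sum \<theta> \<chi> * gauss_sum \<theta> \<psi> =
    jacobi_sum \<chi> \<psi> * gauss_sum \<theta> (\<chi> \<odot> \<psi>) + \<psi> (-1) * (\<Sum>x\<in>UNIV. (\<chi> \<odot> \<psi>) x)"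
proof -
  have "gauss_sum \<theta> \<chi> * gauss_sum \<theta> \<psi> = (\<Sum>x\<in>UNIV. \<Sum>y\<in>UNIV. \<chi> x * \<psi> y * \<theta> (x + y))"
    by (simp add: gauss_sum_def sum_product nontrivial_add_char_add[OF \<theta>] mult_ac)
  also have "\<dots> = (\<Sum>x\<in>UNIV. \<Sum>s\<in>UNIV. \<chi> x * \<psi> (s - x) * \<theta> s)"
  proof (rule sum.cong[OF refl])
    fix x
    show "(\<Sum>y\<in>UNIV. \<chi> x * \<psi> y * \<theta> (x + y)) = (\<Sum>s\<in>UNIV. \<chi> x * \<psi> (s - x) * \<theta> s)"
      by (rule sum.reindex_bij_witness[of _ "\<lambda>s. s - x" "\<lambda>y. x + y"]) auto
  qed
  also have "\<dots> = (\<Sum>s\<in>UNIV. \<Sum>x\<in>UNIV. \<chi> x * \<psi> (s - x) * \<theta> s)"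
    by (rule sum.swap)
  also have "\<dots> = (\<Sum>x\<in>UNIV. \<chi> x * \<psi> (0 - x) * \<theta> 0) +
      (\<Sum>s\<in>UNIV - {0}. \<Sum>x\<in>UNIV. \<chi> x * \<psi> (s - x) * \<theta> s)"
    by (rule sum.remove) auto
  also have "(\<Sum>s\<in>UNIV - {0}. \<Sum>x\<in>UNIV. \<chi> x * \<psi> (s - x) * \<theta> s) =
      (\<Sum>s\<in>UNIV - {0}. jacobi_sum \<chi> \<psi> * ((\<chi> \<odot> \<psi>) s * \<theta> s))"
  proof (rule sum.cong[OF refl])
    fix s :: 'a assume "s \<in> UNIV - {0}"
    then have s: "s \<noteq> 0" by simp
    have "(\<Sum>x\<in>UNIV. \<chi> x * \<psi> (s - x) * \<theta> s) = (\<Sum>x\<in>UNIV. \<chi> (x * s) * \<psi> (s - x * s) * \<theta> s)"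
      by (rule sum_UNIV_mult_right[OF s, symmetric])
    also have "\<dots> = (\<Sum>x\<in>UNIV. (\<chi> x * \<psi> (1 - x)) * ((\<chi> \<odot> \<psi>) s * \<theta> s))"
    proof (rule sum.cong[OF refl])
      fix x
      have "s - x * s = (1 - x) * s" by (simp add: algebra_simps)
      then show "\<chi> (x * s) * \<psi> (s - x * s) * \<theta> s = (\<chi> x * \<psi> (1 - x)) * ((\<chi> \<odot> \<psi>) s * \<theta> s)"
        by (simp add: mult_chars_mult[OF \<chi>] mult_chars_mult[OF \<psi>] char_mult_def)
    qed
    finally show "(\<Sum>x\<in>UNIV. \<chi> x * \<psi> (s - x) * \<theta> s) = jacobi_sum \<chi> \<psi> * ((\<chi> \<odot> \<psi>) s * \<theta> s)"
      by (simp add: jacobi_sum_def sum_distrib_right)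
  qed
  \<comment> \<open>The term \<open>s = 0\<close> can be put back, since
    \<open>\<chi> \<odot> \<psi>\<close> vanishes there.\<close>
  also have "\<dots> = jacobi_sum \<chi> \<psi> * gauss_sum \<theta> (\<chi> \<odot> \<psi>)"
    unfolding gauss_sum_def sum_distrib_left
    by (rule sum.mono_neutral_left) (auto simp: char_mult_def mult_chars_0[OF \<chi>])
  also have "(\<Sum>x\<in>UNIV. \<chi> x * \<psi> (0 - x) * \<theta> 0) = \<psi> (-1) * (\<Sum>x\<in>UNIV. (\<chi> \<odot> \<psi>) x)"
  proof -
    have "\<psi> (0 - x) = \<psi> (-1) * \<psi> x" for x
      using mult_chars_mult[OF \<psi>, of "-1" x] by simp
    then show ?thesis
      by (simp add: nontrivial_add_char_0[OF \<theta>] char_mult_def sum_distrib_left mult_ac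
          del: diff_0)
  qed
  finally show ?thesis by simp
qed

text \<open>The substitution v = u / (1 - u) maps the field without 1 onto the field without -1, so
  the sum is the full (vanishing) character sum minus its term at -1.\<close>

lemma jacobi_sum_char_inv:
  fixes \<chi> :: "'a::{field,finite} \<Rightarrow> complex"
  assumes \<chi>: "\<chi> \<in> mult_chars" and "\<chi> \<noteq> triv_char"
  shows "jacobi_sum \<chi> (char_inv \<chi>) = - \<chi> (-1)"
proof -
  have "jacobi_sum \<chi> (char_inv \<chi>) = (\<Sum>u\<in>UNIV - {1}. \<chi> (u / (1 - u)))"
    unfolding jacobi_sum_def
    by (rule sum.mono_neutral_cong_right)
       (auto simp: char_inv_def mult_chars_0[OF \<chi>] divide_inverse mult_chars_mult[OF \<chi>]
          mult_chars_inverse[OF \<chi>])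
  also have "\<dots> = (\<Sum>v\<in>UNIV - {-1}. \<chi> v)"
  proof (rule sum.reindex_bij_witness[of _ "\<lambda>v. v / (1 + v)" "\<lambda>u. u / (1 - u)"])
    fix u :: 'a assume "u \<in> UNIV - {1}"
    then have u: "1 - u \<noteq> 0" by simp
    then have *: "1 + u / (1 - u) = 1 / (1 - u)" by (simp add: field_simps)
    then show "u / (1 - u) / (1 + u / (1 - u)) = u" using u by simp
    show "u / (1 - u) \<in> UNIV - {-1}" using * u by auto
  next
    fix v :: 'a assume "v \<in> UNIV - {-1}"
    then have v: "1 + v \<noteq> 0" by (auto simp: add_eq_0_iff)
    then have *: "1 - v / (1 + v) = 1 / (1 + v)" by (simp add: field_simps)
    then show "v / (1 + v) / (1 - v / (1 + v)) = v" using v by simp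
    show "v / (1 + v) \<in> UNIV - {1}" using * v by auto
  qed simp
  also have "\<dots> = - \<chi> (-1)"
    using sum_mult_char[OF \<chi>] assms(2) by (simp add: sum_diff1)
  finally show ?thesis .
qed

text \<open>In \<open>gauss_sum_mult\<close> with the inverse character, the Jacobi part contributes
  \<open>\<chi> (-1)\<close> and the part s = 0 contributes q - 1 times
  \<open>\<chi> (-1)\<close>.\<close>

lemma gauss_sum_char_inv:
  fixes \<theta> \<chi> :: "'a::{field,finite} \<Rightarrow> complex"
  assumes \<theta>: "nontrivial_add_char \<theta>" and \<chi>: "\<chi> \<in> mult_chars" and nt: "\<chi> \<noteq> triv_char"
  shows "gauss_sum \<theta> \<chi> * gauss_sum \<theta> (char_inv \<chi>) = \<chi> (-1) * of_nat CARD('a)"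
proof -
  have triv: "\<chi> \<odot> char_inv \<chi> = triv_char"
    using \<chi> by (simp add: char_mult_char_inv_eq_triv_char_iff)
  have "char_inv \<chi> (-1) = \<chi> (-1)"
    using mult_chars_inverse[OF \<chi>, of "-1"] by (simp add: char_inv_def)
  then show ?thesis
    using gauss_sum_mult[OF \<theta> \<chi> char_inv_in_mult_chars[OF \<chi>]]
      sum_mult_char[OF triv_char_in_mult_chars, where 'a='a]
    by (simp add: triv jacobi_sum_char_inv[OF \<chi> nt] gauss_sum_triv_char[OF \<theta>] algebra_simps)
qed

text \<open>Makes all denominators genuine, division by zero being 0 by convention.\<close>

lemma gauss_sum_neq_0:
  assumes \<theta>: "nontrivial_add_char \<theta>" and \<chi>: "\<chi> \<in> mult_chars"
  shows "gauss_sum \<theta> \<chi> \<noteq> 0"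
proof (cases "\<chi> = triv_char")
  case False
  then show ?thesis
    using gauss_sum_char_inv[OF \<theta> \<chi>] mult_chars_eq_0_iff[OF \<chi>, of "-1"] by auto
qed (simp add: gauss_sum_triv_char[OF \<theta>])

text \<open>Generically J(R, B^-1) is g(R) g(B^-1) / g(R B^-1). Applying
  \<open>gauss_sum_char_inv\<close> to R, B and R B^-1 turns this into the quotient wanted on the
  right of the theorem, and the signs at -1 cancel.\<close>

lemma gauss_sum_times_jacobi_sum:
  fixes \<theta> B R :: "'a::{field,finite} \<Rightarrow> complex"
  assumes \<theta>: "nontrivial_add_char \<theta>" and B: "B \<in> mult_chars" "B \<noteq> triv_char"
    and R: "R \<in> mult_chars" "R \<noteq> triv_char"
  shows "gauss_sum \<theta> B * jacobi_sum R (char_inv B) * gauss_sum \<theta> (char_inv R) =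
    of_nat CARD('a) * gauss_sum \<theta> (char_inv R \<odot> B)"
proof (cases "R = B")
  \<comment> \<open>The quotient formula for the Jacobi sum breaks down when
    \<open>R \<odot> char_inv B\<close> is trivial; here both sides are -q.\<close>
  case True
  have "char_inv R \<odot> R = triv_char"
    using R(1) char_mult_char_inv_eq_triv_char_iff[OF R(1) R(1)]
    by (simp add: char_mult_def mult.commute)
  then have "gauss_sum \<theta> (char_inv R \<odot> B) = -1"
    using True by (simp add: gauss_sum_triv_char[OF \<theta>])
  moreover have "gauss_sum \<theta> B * jacobi_sum R (char_inv B) * gauss_sum \<theta> (char_inv R) =
      - R (-1) * (gauss_sum \<theta> R * gauss_sum \<theta> (char_inv R))"
    using jacobi_sum_char_inv[OF R] True by simp
  moreover have "\<dots> = - (R (-1) * R (-1)) * of_nat CARD('a)"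
    by (simp add: gauss_sum_char_inv[OF \<theta> R])
  ultimately show ?thesis by (simp add: mult_chars_minus_1_square[OF R(1)])
next
  case False
  let ?q = "of_nat CARD('a) :: complex"
  have iB: "char_inv B \<in> mult_chars" by (rule char_inv_in_mult_chars[OF B(1)])
  let ?P = "R \<odot> char_inv B"
  have P: "?P \<in> mult_chars" "?P \<noteq> triv_char"
    using False by (simp_all add: char_mult_in_mult_chars R B iB char_mult_char_inv_eq_triv_char_iff)
  have Pinv: "char_inv ?P = char_inv R \<odot> B"
    by (auto simp: fun_eq_iff char_inv_def char_mult_def)
  have Pm: "?P (-1) = R (-1) * B (-1)"
    using mult_chars_inverse[OF B(1), of "-1"] by (simp add: char_mult_def char_inv_def)
  have J: "jacobi_sum R (char_inv B) * gauss_sum \<theta> ?P = gauss_sum \<theta> R * gauss_sum \<theta> (char_inv B)"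
    using gauss_sum_mult[OF \<theta> R(1) iB] sum_mult_char[OF P(1)] P(2) by simp
  have "gauss_sum \<theta> ?P * (gauss_sum \<theta> B * jacobi_sum R (char_inv B) * gauss_sum \<theta> (char_inv R)) =
      (gauss_sum \<theta> R * gauss_sum \<theta> (char_inv R)) * (gauss_sum \<theta> B * gauss_sum \<theta> (char_inv B))"
    using J by (simp add: algebra_simps)
  also have "\<dots> = ?q * (R (-1) * B (-1) * ?q)"
    by (simp add: gauss_sum_char_inv[OF \<theta> R] gauss_sum_char_inv[OF \<theta> B])
  also have "R (-1) * B (-1) * ?q = gauss_sum \<theta> ?P * gauss_sum \<theta> (char_inv R \<odot> B)"
    using gauss_sum_char_inv[OF \<theta> P] by (simp add: Pinv Pm)
  finally show ?thesis using gauss_sum_neq_0[OF \<theta> P(1)] by (simp add: mult_ac)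
qed

subsection \<open>The value at minus one\<close>

text \<open>After multiplying out, the summation character occurs only through its value at -xy /
  (zw). Dual orthogonality forces w = -xy / z and contributes the factor q - 1.\<close>

lemma sum_gauss_sum_product:
  fixes \<theta> A B C :: "'a::{field,finite} \<Rightarrow> complex"
  assumes \<theta>: "nontrivial_add_char \<theta>"
    and A: "A \<in> mult_chars" and B: "B \<in> mult_chars" and C: "C \<in> mult_chars"
  shows "(\<Sum>\<chi>\<in>mult_chars. gauss_sum \<theta> (A \<odot> \<chi>) * gauss_sum \<theta> (B \<odot> \<chi>) *
      gauss_sum \<theta> (char_inv (C \<odot> \<chi>)) * gauss_sum \<theta> (char_inv \<chi>) * \<chi> (-1)) =
    (of_nat CARD('a) - 1) * (\<Sum>x\<in>UNIV. \<Sum>y\<in>UNIV. \<Sum>z\<in>UNIV.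
      A x * B y * inverse (C z) * \<theta> (x + y + z - x * y / z))"
    (is "?lhs = ?n * ?rhs")
proof -
  note \<theta>_add = nontrivial_add_char_add[OF \<theta>]
  have "?lhs = (\<Sum>\<chi>\<in>mult_chars. \<Sum>x\<in>UNIV. \<Sum>y\<in>UNIV. \<Sum>z\<in>UNIV. \<Sum>w\<in>UNIV.
      A x * B y * inverse (C z) * \<theta> (x + y + z + w) * \<chi> (- (x * y) * inverse (z * w)))"
  proof (rule sum.cong[OF refl])
    fix \<chi> :: "'a \<Rightarrow> complex" assume \<chi>: "\<chi> \<in> mult_chars"
    have \<chi>_eq: "\<chi> (- (x * y) * inverse (z * w)) =
        \<chi> (-1) * \<chi> x * \<chi> y * inverse (\<chi> z) * inverse (\<chi> w)" for x y z w
    proof -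
      have "- (x * y) * inverse (z * w) = -1 * x * y * inverse z * inverse w" by simp
      then show ?thesis by (simp only: mult_chars_mult[OF \<chi>] mult_chars_inverse[OF \<chi>])
    qed
    show "gauss_sum \<theta> (A \<odot> \<chi>) * gauss_sum \<theta> (B \<odot> \<chi>) *
        gauss_sum \<theta> (char_inv (C \<odot> \<chi>)) * gauss_sum \<theta> (char_inv \<chi>) * \<chi> (-1) =
      (\<Sum>x\<in>UNIV. \<Sum>y\<in>UNIV. \<Sum>z\<in>UNIV. \<Sum>w\<in>UNIV.
        A x * B y * inverse (C z) * \<theta> (x + y + z + w) * \<chi> (- (x * y) * inverse (z * w)))"
      (is "?l = ?r")
    proof -
      \<comment> \<open>The factors are nested by variable, so that each inner sum can be pulled out
        in turn.\<close>
      have "?r = (\<Sum>x\<in>UNIV. \<Sum>y\<in>UNIV. \<Sum>z\<in>UNIV. \<Sum>w\<in>UNIV.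
          (A x * \<chi> x * \<theta> x) * ((B y * \<chi> y * \<theta> y) *
          ((inverse (C z) * inverse (\<chi> z) * \<theta> z) * ((inverse (\<chi> w) * \<theta> w) * \<chi> (-1)))))"
        by (intro sum.cong refl)
          (unfold \<chi>_eq \<theta>_add, simp only: mult_ac)
      also have "\<dots> = ?l"
        unfolding sum_distrib_left[symmetric] sum_distrib_right[symmetric]
        by (simp only: gauss_sum_def char_mult_def char_inv_def inverse_mult_distrib mult.assoc)
      finally show ?thesis by simp
    qed
  qed
  also have "\<dots> = (\<Sum>x\<in>UNIV. \<Sum>y\<in>UNIV. \<Sum>z\<in>UNIV. \<Sum>w\<in>UNIV.
      A x * B y * inverse (C z) * \<theta> (x + y + z + w) * (\<Sum>\<chi>\<in>mult_chars. \<chi> (- (x * y) * inverse (z * w))))"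
    unfolding sum_distrib_left
    by (simp only: sum.swap[where B = mult_chars and A = UNIV])
  also have "\<dots> = (\<Sum>x\<in>UNIV. \<Sum>y\<in>UNIV. \<Sum>z\<in>UNIV.
      ?n * (A x * B y * inverse (C z) * \<theta> (x + y + z - x * y / z)))"
  proof (intro sum.cong refl)
    fix x y z :: 'a
    let ?f = "\<lambda>w. A x * B y * inverse (C z) * \<theta> (x + y + z + w)"
    show "(\<Sum>w\<in>UNIV. ?f w * (\<Sum>\<chi>\<in>mult_chars. \<chi> (- (x * y) * inverse (z * w)))) =
        ?n * (A x * B y * inverse (C z) * \<theta> (x + y + z - x * y / z))"
    proof (cases "x = 0 \<or> y = 0 \<or> z = 0")
      \<comment> \<open>Both sides are 0: \<open>A\<close> and \<open>B\<close> vanish at 0, and so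
        does the inverse of \<open>C\<close>.\<close>
      case True
      then show ?thesis using mult_chars_0[OF A] mult_chars_0[OF B] mult_chars_0[OF C] by auto
    next
      case False
      have iff: "- (x * y) * inverse (z * w) = 1 \<longleftrightarrow> w = - (x * y / z)" for w
        using False by (cases "w = 0") (auto simp: field_simps)
      have "(\<Sum>w\<in>UNIV. ?f w * (\<Sum>\<chi>\<in>mult_chars. \<chi> (- (x * y) * inverse (z * w)))) =
          (\<Sum>w\<in>UNIV. if w = - (x * y / z) then ?f w * ?n else 0)"
        unfolding sum_mult_chars iff by (rule sum.cong) auto
      then show ?thesis by simp
    qed
  qed
  also have "\<dots> = ?n * ?rhs" by (simp add: sum_distrib_left)
  finally show ?thesis .
qed

text \<open>The substitution x = t z exploits the special parameters: with C = A B^-1 the characters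
  reduce to A(t) B(z) B(y), and at the argument -1 the exponent becomes z (1 + t) + y (1 - t). For
  fixed t the sums over z and y therefore separate.\<close>

lemma hyp2F1_star_minus_1:
  fixes \<theta> A B :: "'a::{field,finite} \<Rightarrow> complex"
  assumes \<theta>: "nontrivial_add_char \<theta>" and A: "A \<in> mult_chars" and B: "B \<in> mult_chars"
  shows "hyp2F1_star \<theta> A B (A \<odot> char_inv B) (-1) =
    (\<Sum>t\<in>UNIV. A t * (\<Sum>z\<in>UNIV. B z * \<theta> (z * (1 + t))) * (\<Sum>y\<in>UNIV. B y * \<theta> (y * (1 - t)))) /
    (gauss_sum \<theta> A * gauss_sum \<theta> B * gauss_sum \<theta> (char_inv A \<odot> B))"
proof -
  let ?C = "A \<odot> char_inv B"
  let ?n = "of_nat CARD('a) - 1 :: complex"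
  have C: "?C \<in> mult_chars" using A B by (intro char_mult_in_mult_chars char_inv_in_mult_chars)
  have Cinv: "char_inv ?C = char_inv A \<odot> B"
    by (auto simp: fun_eq_iff char_inv_def char_mult_def)
  note \<theta>_add = nontrivial_add_char_add[OF \<theta>]
  have "(\<Sum>x\<in>UNIV. \<Sum>y\<in>UNIV. \<Sum>z\<in>UNIV. A x * B y * inverse (?C z) * \<theta> (x + y + z - x * y / z)) =
      (\<Sum>z\<in>UNIV. \<Sum>y\<in>UNIV. \<Sum>x\<in>UNIV. A x * B y * inverse (?C z) * \<theta> (x + y + z - x * y / z))"
    by (subst sum.swap, subst (2) sum.swap, subst sum.swap) (rule refl)
  also have "\<dots> = (\<Sum>z\<in>UNIV. \<Sum>y\<in>UNIV. \<Sum>t\<in>UNIV. A t * (B z * \<theta> (z * (1 + t))) * (B y * \<theta> (y * (1 - t))))"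
  proof (rule sum.cong[OF refl], rule sum.cong[OF refl])
    fix z y :: 'a
    show "(\<Sum>x\<in>UNIV. A x * B y * inverse (?C z) * \<theta> (x + y + z - x * y / z)) =
        (\<Sum>t\<in>UNIV. A t * (B z * \<theta> (z * (1 + t))) * (B y * \<theta> (y * (1 - t))))"
    proof (cases "z = 0")
      case True
      then show ?thesis using mult_chars_0[OF B] mult_chars_0[OF C] by simp
    next
      case z: False
      have "(\<Sum>x\<in>UNIV. A x * B y * inverse (?C z) * \<theta> (x + y + z - x * y / z)) =
          (\<Sum>t\<in>UNIV. A (t * z) * B y * inverse (?C z) * \<theta> (t * z + y + z - t * z * y / z))"
        by (rule sum_UNIV_mult_right[OF z, symmetric])
      also have "\<dots> = (\<Sum>t\<in>UNIV. A t * (B z * \<theta> (z * (1 + t))) * (B y * \<theta> (y * (1 - t))))"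
      proof (intro sum.cong refl)
        fix t
        have "t * z + y + z - t * z * y / z = z * (1 + t) + y * (1 - t)"
          using z by (simp add: algebra_simps)
        then have e1: "\<theta> (t * z + y + z - t * z * y / z) = \<theta> (z * (1 + t)) * \<theta> (y * (1 - t))"
          by (simp only: \<theta>_add)
        have e2: "A (t * z) * inverse (?C z) = A t * B z"
          using z mult_chars_eq_0_iff[OF A] by (simp add: mult_chars_mult[OF A] char_mult_def char_inv_def)
        have "A (t * z) * B y * inverse (?C z) * \<theta> (t * z + y + z - t * z * y / z) =
            (A (t * z) * inverse (?C z)) * B y * \<theta> (t * z + y + z - t * z * y / z)"
          by (simp only: mult_ac)
        then show "A (t * z) * B y * inverse (?C z) * \<theta> (t * z + y + z - t * z * y / z) =
            A t * (B z * \<theta> (z * (1 + t))) * (B y * \<theta> (y * (1 - t)))"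
          unfolding e1 e2 by (simp only: mult_ac)
      qed
      finally show ?thesis .
    qed
  qed
  also have "\<dots> = (\<Sum>t\<in>UNIV. \<Sum>z\<in>UNIV. \<Sum>y\<in>UNIV. A t * (B z * \<theta> (z * (1 + t))) * (B y * \<theta> (y * (1 - t))))"
    by (subst (2) sum.swap, subst sum.swap) (rule refl)
  also have "\<dots> = (\<Sum>t\<in>UNIV. A t * (\<Sum>z\<in>UNIV. B z * \<theta> (z * (1 + t))) * (\<Sum>y\<in>UNIV. B y * \<theta> (y * (1 - t))))"
    by (simp only: sum_distrib_left sum_distrib_right) (subst (2) sum.swap, rule refl)
  finally have S: "(\<Sum>x\<in>UNIV. \<Sum>y\<in>UNIV. \<Sum>z\<in>UNIV. A x * B y * inverse (?C z) * \<theta> (x + y + z - x * y / z)) =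
      (\<Sum>t\<in>UNIV. A t * (\<Sum>z\<in>UNIV. B z * \<theta> (z * (1 + t))) * (\<Sum>y\<in>UNIV. B y * \<theta> (y * (1 - t))))"
    (is "_ = ?S") .
  have "hyp2F1_star \<theta> A B ?C (-1) = (\<Sum>\<chi>\<in>mult_chars. gauss_sum \<theta> (A \<odot> \<chi>) * gauss_sum \<theta> (B \<odot> \<chi>) *
      gauss_sum \<theta> (char_inv (?C \<odot> \<chi>)) * gauss_sum \<theta> (char_inv \<chi>) * \<chi> (-1)) /
      (?n * (gauss_sum \<theta> A * gauss_sum \<theta> B * gauss_sum \<theta> (char_inv ?C)))"
    unfolding hyp2F1_star_def sum_divide_distrib sum_distrib_left
    by (rule sum.cong) (simp_all add: mult_ac)
  then show ?thesis
    unfolding sum_gauss_sum_product[OF \<theta> A B C] S Cinv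
    using of_nat_CARD_minus_1_neq_0[where 'a='a] by simp
qed

text \<open>Group the t by u = t^2 and rewrite each fibre sum by
  \<open>sum_square_root_chars\<close>. If A is not a square, the right side is an empty
  sum.\<close>

lemma sum_char_one_minus_square:
  fixes A C :: "'a::{field,finite} \<Rightarrow> complex"
  assumes A: "A \<in> mult_chars"
  shows "(\<Sum>t\<in>UNIV. A t * C (1 - t * t)) = (\<Sum>R | R \<in> mult_chars \<and> R \<odot> R = A. jacobi_sum R C)"
proof -
  have "(\<Sum>t\<in>UNIV. A t * C (1 - t * t)) = (\<Sum>u\<in>UNIV. \<Sum>t | t \<in> UNIV \<and> t * t = u. A t * C (1 - t * t))"
    by (rule sum.group[symmetric]) auto
  also have "\<dots> = (\<Sum>u\<in>UNIV. (\<Sum>t | t * t = u. A t) * C (1 - u))"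
    by (simp add: sum_distrib_right)
  also have "\<dots> = (\<Sum>u\<in>UNIV. \<Sum>R | R \<in> mult_chars \<and> R \<odot> R = A. R u * C (1 - u))"
    by (simp add: sum_square_root_chars[OF A, symmetric] sum_distrib_right)
  also have "\<dots> = (\<Sum>R | R \<in> mult_chars \<and> R \<odot> R = A. jacobi_sum R C)"
    unfolding jacobi_sum_def by (rule sum.swap)
  finally show ?thesis .
qed

text \<open>Otherwise x and x + 1 form pairs that partition the field, and its cardinality is
  even.\<close>

lemma one_neq_minus_one_if_odd_CARD:
  assumes "odd CARD('a::{field,finite})"
  shows "(1::'a) \<noteq> -1"
proof
  assume eq: "(1::'a) = -1"
  have inv: "x + 1 + 1 = x" for x :: 'a
    using eq by (metis add.assoc add.right_inverse add_0_right)
  let ?C = "range (\<lambda>x::'a. {x, x + 1})"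
  have "2 * card ?C = card (\<Union>?C)"
  proof (rule card_partition)
    show "card c = 2" if "c \<in> ?C" for c using that by auto
    show "c \<inter> d = {}" if "c \<in> ?C" "d \<in> ?C" "c \<noteq> d" for c d
      using that inv by fastforce
  qed auto
  moreover have "\<Union>?C = UNIV" by auto
  ultimately have "even CARD('a)" by (metis dvd_triv_left)
  with assms show False by simp
qed

text \<open>The last hypothesis excludes trivial \<open>B\<close> in characteristic two, where the
  identity fails: 1 and -1 coincide, the left side is 2 - q, and the right side is 1 because A has
  exactly one square root.\<close>

theorem theorem1p10:
  fixes \<theta> A B :: "'a::{field,finite} \<Rightarrow> complex"
  assumes "nontrivial_add_char \<theta>"
    and "A \<in> mult_chars" and "B \<in> mult_chars"
    and "A \<noteq> triv_char"
    and "odd CARD('a) \<or> B \<noteq> triv_char"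
  shows "hyp2F1_star \<theta> A B (A \<odot> char_inv B) (-1) =
    (if \<not> is_square_char A then 0
     else \<Sum>R\<in>{R \<in> mult_chars. R \<odot> R = A}.
            gauss_sum \<theta> (char_inv A) * gauss_sum \<theta> (char_inv R \<odot> B) /
            (gauss_sum \<theta> (char_inv R) * gauss_sum \<theta> (char_inv A \<odot> B)))"
proof -
  note \<theta> = assms(1) and A = assms(2) and B = assms(3) and nt = assms(4)
  let ?q = "of_nat CARD('a) :: complex"
  let ?D = "char_inv A \<odot> B"
  let ?K = "\<lambda>c. \<Sum>z\<in>UNIV. B z * \<theta> (z * c)"
  let ?Rs = "{R \<in> mult_chars. R \<odot> R = A}"
  let ?rhs = "\<Sum>R\<in>?Rs. gauss_sum \<theta> (char_inv A) * gauss_sum \<theta> (char_inv R \<odot> B) /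
            (gauss_sum \<theta> (char_inv R) * gauss_sum \<theta> ?D)"
  have D: "?D \<in> mult_chars" using A B by (intro char_mult_in_mult_chars char_inv_in_mult_chars)
  have gA: "gauss_sum \<theta> A \<noteq> 0" and gB: "gauss_sum \<theta> B \<noteq> 0" and gD: "gauss_sum \<theta> ?D \<noteq> 0"
    using gauss_sum_neq_0[OF \<theta>] A B D by auto
  have q0: "?q \<noteq> 0" by simp
  \<comment> \<open>One formula covers both cases: for a nonsquare \<open>A\<close> the index set
    \<open>?Rs\<close> is empty.\<close>
  have main: "hyp2F1_star \<theta> A B (A \<odot> char_inv B) (-1) = ?rhs"
  proof (cases "B = triv_char")
    case False
    \<comment> \<open>This includes \<open>c = 0\<close>: the left side is the sum of a nontrivial
      character, and the right side has \<open>inverse 0 = 0\<close>.\<close>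
    have K: "?K c = char_inv B c * gauss_sum \<theta> B" for c
    proof (cases "c = 0")
      case True
      then show ?thesis using sum_mult_char[OF B] False
        by (simp add: nontrivial_add_char_0[OF \<theta>] char_inv_def mult_chars_0[OF B])
    next
      case False
      then show ?thesis using gauss_sum_twist[OF B] by (simp add: char_inv_def)
    qed
    have iB: "char_inv B \<in> mult_chars" by (rule char_inv_in_mult_chars[OF B])
    have "(\<Sum>t\<in>UNIV. A t * ?K (1 + t) * ?K (1 - t)) =
        gauss_sum \<theta> B * gauss_sum \<theta> B * (\<Sum>t\<in>UNIV. A t * char_inv B (1 - t * t))"
      unfolding K sum_distrib_left
    proof (rule sum.cong[OF refl])
      fix t :: 'a
      have "1 - t * t = (1 + t) * (1 - t)" by (simp add: algebra_simps)
      then show "A t * (char_inv B (1 + t) * gauss_sum \<theta> B) * (char_inv B (1 - t) * gauss_sum \<theta> B) =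
          gauss_sum \<theta> B * gauss_sum \<theta> B * (A t * char_inv B (1 - t * t))"
        using mult_chars_mult[OF iB] by simp
    qed
    then have "hyp2F1_star \<theta> A B (A \<odot> char_inv B) (-1) =
        (\<Sum>R\<in>?Rs. gauss_sum \<theta> B * jacobi_sum R (char_inv B) / (gauss_sum \<theta> A * gauss_sum \<theta> ?D))"
      unfolding hyp2F1_star_minus_1[OF \<theta> A B] sum_char_one_minus_square[OF A]
      using gB by (simp add: sum_distrib_left sum_divide_distrib)
    also have "\<dots> = ?rhs"
    proof (rule sum.cong[OF refl])
      fix R assume "R \<in> ?Rs"
      then have R: "R \<in> mult_chars" "R \<odot> R = A" by auto
      then have R_nt: "R \<noteq> triv_char" using nt by (auto simp: char_mult_def triv_char_def)
      have gR: "gauss_sum \<theta> (char_inv R) \<noteq> 0"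
        by (rule gauss_sum_neq_0[OF \<theta> char_inv_in_mult_chars[OF R(1)]])
      \<comment> \<open>Since A = R^2, no sign appears in g(A) g(A^-1) = q. Replacing q by this
        product in \<open>gauss_sum_times_jacobi_sum\<close> gives the claimed summand.\<close>
      have "A (-1) = 1" using R mult_chars_minus_1_square[OF R(1)] by (auto simp: char_mult_def)
      then have gAA: "gauss_sum \<theta> A * gauss_sum \<theta> (char_inv A) = ?q"
        using gauss_sum_char_inv[OF \<theta> A nt] by simp
      show "gauss_sum \<theta> B * jacobi_sum R (char_inv B) / (gauss_sum \<theta> A * gauss_sum \<theta> ?D) =
          gauss_sum \<theta> (char_inv A) * gauss_sum \<theta> (char_inv R \<odot> B) / (gauss_sum \<theta> (char_inv R) * gauss_sum \<theta> ?D)"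
        using gauss_sum_times_jacobi_sum[OF \<theta> B False R(1) R_nt, folded gAA] gA gD gR
        by (simp add: frac_eq_eq mult_ac)
    qed
    finally show ?thesis .
  next
    case True
    then have ne: "(1::'a) \<noteq> -1" using assms(5) one_neq_minus_one_if_odd_CARD by blast
    have K: "?K c = (if c = 0 then ?q - 1 else -1)" for c
      using sum_mult_char[OF B] gauss_sum_twist[OF B, of c \<theta>] gauss_sum_triv_char[OF \<theta>] True
      by (cases "c = 0") (simp_all add: nontrivial_add_char_0[OF \<theta>], simp add: triv_char_def)
    have two: "{t::'a. t * t = 1} = {1, -1}" by (auto simp: square_eq_1_iff)
    have iff: "1 + t = 0 \<longleftrightarrow> t = -1" "1 - t = 0 \<longleftrightarrow> t = 1" for t :: 'a
      by (auto simp: add_eq_0_iff)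
    \<comment> \<open>The product of the two \<open>?K\<close> values is 1, except at t = 1 and t =
      -1. As these points differ, exactly one factor is exceptional there and the product is 1 -
      q.\<close>
    have "(\<Sum>t\<in>UNIV. A t * ?K (1 + t) * ?K (1 - t)) =
        (\<Sum>t\<in>UNIV. A t - (if t = -1 then ?q * A t else 0) - (if t = 1 then ?q * A t else 0))"
      unfolding K iff using ne by (intro sum.cong refl) (auto simp: algebra_simps)
    also have "\<dots> = - ?q * (1 + A (-1))"
      using sum_mult_char[OF A] nt by (simp add: sum_subtractf mult_chars_1[OF A]) (simp add: algebra_simps)
    finally have S: "(\<Sum>t\<in>UNIV. A t * ?K (1 + t) * ?K (1 - t)) = - ?q * (1 + A (-1))" .
    have D_eq: "?D = char_inv A"
      using True mult_chars_0[OF A] by (auto simp: fun_eq_iff char_mult_def char_inv_def triv_char_def)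
    have Am: "A (-1) * A (-1) = 1" by (rule mult_chars_minus_1_square[OF A])
    have Am0: "A (-1) \<noteq> 0" using Am by auto
    have "hyp2F1_star \<theta> A B (A \<odot> char_inv B) (-1) = ?q * (1 + A (-1)) / (A (-1) * ?q)"
      unfolding hyp2F1_star_minus_1[OF \<theta> A B] S D_eq
      using gauss_sum_char_inv[OF \<theta> A nt] by (simp add: True gauss_sum_triv_char[OF \<theta>])
    also have "\<dots> = 1 + A (-1)"
      using Am Am0 q0 by (simp add: field_simps)
    \<comment> \<open>1 + A(-1) is the sum of A over the solutions of t^2 = 1, so
      \<open>sum_square_root_chars\<close> at u = 1 makes it the number of square roots of A. Each
      summand of \<open>?rhs\<close> is 1 as well, because multiplication by the trivial
      \<open>B\<close> changes no character.\<close>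
    also have "\<dots> = (\<Sum>R\<in>?Rs. R 1)"
      unfolding sum_square_root_chars[OF A] two using ne by (simp add: mult_chars_1[OF A])
    also have "\<dots> = ?rhs"
    proof (rule sum.cong[OF refl])
      fix R assume "R \<in> ?Rs"
      then have R: "R \<in> mult_chars" by simp
      have "char_inv R \<odot> B = char_inv R"
        using True mult_chars_0[OF R] by (auto simp: fun_eq_iff char_mult_def char_inv_def triv_char_def)
      moreover have "gauss_sum \<theta> (char_inv R) \<noteq> 0"
        by (rule gauss_sum_neq_0[OF \<theta> char_inv_in_mult_chars[OF R]])
      ultimately show "R 1 = gauss_sum \<theta> (char_inv A) * gauss_sum \<theta> (char_inv R \<odot> B) /
            (gauss_sum \<theta> (char_inv R) * gauss_sum \<theta> ?D)"
        using gD by (simp add: D_eq mult_chars_1[OF R])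
    qed
    finally show ?thesis .
  qed
  have "?Rs = {}" if "\<not> is_square_char A" using that by (auto simp: is_square_char_def)
  then show ?thesis unfolding main by (metis (no_types, lifting) sum.empty)
qed

end
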